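(* Let $\mathcal{D}\in\mathbb{R}^{I_1\times\cdots\times I_N}$ and $\mathbf{A}_n\in\mathbb{R}^{I_n\times I_n}$ ($n=1,\dots,N$) be given, and assume that the Sylvester tensor equation $\mathcal{X}\times_1\mathbf{A}_1+\cdots+\mathcal{X}\times_N\mathbf{A}_N=\mathcal{D}$ is consistent. Then for any initial tensor $\mathcal{X}_0\in\mathbb{R}^{I_1\times\cdots\times I_N}$, the PTBiCOR algorithm converges to an exact solution of this equation in at most $M=I_1\times I_2\times\cdots\times I_N$ iteration steps in the absence of roundoff errors.
   Context: For $\mathcal{X}\in\mathbb{R}^{I_1\times\cdots\times I_N}$ and $\mathbf{A}\in\mathbb{R}^{J\times I_n}$, the $n$-mode product is $(\mathcal{X}\times_n\mathbf{A})_{i_1\dots i_{n-1}\,j\,i_{n+1}\dots i_N}=\sum_{i_n=1}^{I_n}x_{i_1\dots i_N}a_{j i_n}$. The inner product is $\langle\mathcal{X},\mathcal{Y}\rangle=\sum_{i_1,\dots,i_N}x_{i_1\dots i_N}y_{i_1\dots i_N}$. The Sylvester tensor equation is consistent if it has at least one solution $\mathcal{X}\in\mathbb{R}^{I_1\times\cdots\times I_N}$. Preconditioner: $\mathbf{Q}_i\in\mathbb{R}^{I_{N+1-i}\times I_{N+1-i}}$ ($i=1,\dots,N$) are nonsingular matrices with $\mathbf{Q}_i\approx a_{i1}\mathbf{A}_{N+1-i}+a_{i2}\mathbf{E}_{I_{N+1-i}}$, where $\mathbf{E}_k$ is the identity matrix of order $k$ and the real parameters $a_{i1},a_{i2}$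 are computed by numerical optimization so that $\mathbf{Q}_1^{-1}\otimes\cdots\otimes\mathbf{Q}_N^{-1}$ approximates the inverse of $\mathbf{E}_{I_N}\otimes\cdots\otimes\mathbf{E}_{I_2}\otimes\mathbf{A}_1+\cdots+\mathbf{A}_N\otimes\mathbf{E}_{I_{N-1}}\otimes\cdots\otimes\mathbf{E}_{I_1}$ ($\otimes$ is the Kronecker product; $\approx$ is informal). Set $\tilde{\mathcal{D}}=\mathcal{D}\times_1\mathbf{Q}_N^{-1}\times_2\mathbf{Q}_{N-1}^{-1}\cdots\times_N\mathbf{Q}_1^{-1}$ (mode $n$ is multiplied by $\mathbf{Q}_{N+1-n}^{-1}$), and $$\tilde{\mathcal{L}}(\mathcal{X})=\sum_{n=1}^N \mathcal{X}\times_1\mathbf{B}^{(n)}_1\times_2\cdots\times_N\mathbf{B}^{(n)}_N,\qquad \tilde{\mathcal{L}}^T(\mathcal{X})=\sum_{n=1}^N \mathcal{X}\times_1(\mathbf{B}^{(n)}_1)^T\times_2\cdots\times_N(\mathbf{B}^{(n)}_N)^T,$$ where $\mathbf{B}^{(n)}_n=\mathbf{Q}_{N+1-n}^{-1}\mathbf{A}_n$ and $\mathbf{B}^{(n)}_m=\mathbf{Q}_{N+1-m}^{-1}$ for $m\neq n$. PTBiCOR algorithm (preconditioned tensor biconjugate $\tilde{\mathcal{L}}$-orthogonal residual algorithm): given an initial guess $\mathcal{X}_0$, set $\mathcal{R}_0=\tilde{\mathcal{D}}-\tilde{\mathcal{L}}(\mathcal{X}_0)$, $\mathcal{R}_0^*=\tilde{\mathcal{L}}(\mathcal{R}_0)$,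 $\mathcal{P}_{-1}^*=\mathcal{P}_{-1}=0$, $\beta_{-1}=0$. For $n=0,1,\dots$, until convergence: $\mathcal{P}_n=\mathcal{R}_n+\beta_{n-1}\mathcal{P}_{n-1}$; $\mathcal{P}_n^*=\mathcal{R}_n^*+\beta_{n-1}\mathcal{P}_{n-1}^*$; $\mathcal{S}_n=\tilde{\mathcal{L}}(\mathcal{P}_n)$; $\mathcal{S}_n^*=\tilde{\mathcal{L}}^T(\mathcal{P}_n^* )$; $\mathcal{T}_n=\tilde{\mathcal{L}}(\mathcal{R}_n)$; $\alpha_n=\langle\mathcal{R}_n^*,\mathcal{T}_n\rangle/\langle\mathcal{S}_n^*,\mathcal{S}_n\rangle$; $\mathcal{X}_{n+1}=\mathcal{X}_n+\alpha_n\mathcal{P}_n$; $\mathcal{R}_{n+1}=\mathcal{R}_n-\alpha_n\mathcal{S}_n$; $\mathcal{R}_{n+1}^*=\mathcal{R}_n^*-\alpha_n\mathcal{S}_n^*$; $\mathcal{T}_{n+1}=\tilde{\mathcal{L}}(\mathcal{R}_{n+1})$; $\beta_n=\langle\mathcal{R}_{n+1}^*,\mathcal{T}_{n+1}\rangle/\langle\mathcal{R}_n^*,\mathcal{T}_n\rangle$.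
   Formalization: Adds the hypothesis that no breakdown occurs: the denominators of α_n and β_n are nonzero as long as the residuals are nonzero; without it the claim fails, e.g. for N=1, A_1=[[0,1],[0,0]], D=(1,0), X_0=0, where α_0=0/0. *)

theory Defs
  imports "Jordan_Normal_Form.Gauss_Jordan_Elimination" "HOL-Library.FuncSet"
begin

text \<open>
  Modes are numbered 1, ..., N as usual, but the index in each mode starts at 0, in accordance with
  the type of matrices: a multi-index is a function with value in \<open>{..<I n}\<close> at each mode n. A tensor
  of shape I is a real function of multi-indices that vanishes off the index box, so that equality
  of tensors is equality of functions.
\<close>

type_synonym tensor = "(nat \<Rightarrow> nat) \<Rightarrow> real"

definition multi_indices :: "nat \<Rightarrow> (nat \<Rightarrow> nat) \<Rightarrow> (nat \<Rightarrow> nat) set" where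
  "multi_indices N I = (\<Pi>\<^sub>E n\<in>{1..N}. {..<I n})"

definition tensor_space :: "nat \<Rightarrow> (nat \<Rightarrow> nat) \<Rightarrow> tensor set" where
  "tensor_space N I = {X. \<forall>i. i \<notin> multi_indices N I \<longrightarrow> X i = 0}"

definition zero_tensor :: tensor where
  "zero_tensor = (\<lambda>i. 0)"

definition tensor_inner :: "nat \<Rightarrow> (nat \<Rightarrow> nat) \<Rightarrow> tensor \<Rightarrow> tensor \<Rightarrow> real" where
  "tensor_inner N I X Y = (\<Sum>i\<in>multi_indices N I. X i * Y i)"

text \<open>
  For X of shape I and a J by \<open>I n\<close> matrix A, the n-mode product has shape \<open>I(n := J)\<close>. It vanishes
  off its index box, since X vanishes off its own and the case distinction handles mode n.
\<close>

definition mode_prod :: "tensor \<Rightarrow> nat \<Rightarrow> real mat \<Rightarrow> tensor" where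
  "mode_prod X n A =
     (\<lambda>i. if i n < dim_row A then (\<Sum>k<dim_col A. X (i(n := k)) * A $$ (i n, k)) else 0)"

fun multi_mode_prod :: "nat \<Rightarrow> tensor \<Rightarrow> (nat \<Rightarrow> real mat) \<Rightarrow> tensor" where
  "multi_mode_prod 0 X B = X"
| "multi_mode_prod (Suc N) X B = mode_prod (multi_mode_prod N X B) (Suc N) (B (Suc N))"

definition sylvester_op :: "nat \<Rightarrow> (nat \<Rightarrow> real mat) \<Rightarrow> tensor \<Rightarrow> tensor" where
  "sylvester_op N A X = (\<lambda>i. \<Sum>n=1..N. mode_prod X n (A n) i)"

definition sylvester_solution ::
    "nat \<Rightarrow> (nat \<Rightarrow> nat) \<Rightarrow> (nat \<Rightarrow> real mat) \<Rightarrow> tensor \<Rightarrow> tensor \<Rightarrow> bool" where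
  "sylvester_solution N I A D X \<longleftrightarrow> X \<in> tensor_space N I \<and> sylvester_op N A X = D"

definition sylvester_consistent ::
    "nat \<Rightarrow> (nat \<Rightarrow> nat) \<Rightarrow> (nat \<Rightarrow> real mat) \<Rightarrow> tensor \<Rightarrow> bool" where
  "sylvester_consistent N I A D \<longleftrightarrow> (\<exists>X. sylvester_solution N I A D X)"

text \<open>Only meaningful for invertible matrices.\<close>

definition inv_mat :: "real mat \<Rightarrow> real mat" where
  "inv_mat A = the (mat_inverse A)"

definition prec_factor ::
    "nat \<Rightarrow> (nat \<Rightarrow> real mat) \<Rightarrow> (nat \<Rightarrow> real mat) \<Rightarrow> nat \<Rightarrow> nat \<Rightarrow> real mat" where
  "prec_factor N A Q n m =
     (if m = n then inv_mat (Q (N + 1 - n)) * A n else inv_mat (Q (N + 1 - m)))"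

definition prec_op :: "nat \<Rightarrow> (nat \<Rightarrow> real mat) \<Rightarrow> (nat \<Rightarrow> real mat) \<Rightarrow> tensor \<Rightarrow> tensor" where
  "prec_op N A Q X = (\<lambda>i. \<Sum>n=1..N. multi_mode_prod N X (prec_factor N A Q n) i)"

definition prec_op_transp ::
    "nat \<Rightarrow> (nat \<Rightarrow> real mat) \<Rightarrow> (nat \<Rightarrow> real mat) \<Rightarrow> tensor \<Rightarrow> tensor" where
  "prec_op_transp N A Q X =
     (\<lambda>i. \<Sum>n=1..N. multi_mode_prod N X (\<lambda>m. transpose_mat (prec_factor N A Q n m)) i)"

definition prec_rhs :: "nat \<Rightarrow> (nat \<Rightarrow> real mat) \<Rightarrow> tensor \<Rightarrow> tensor" where
  "prec_rhs N Q D = multi_mode_prod N D (\<lambda>n. inv_mat (Q (N + 1 - n)))"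

text \<open>
  The state on entry to iteration n consists of the iterate \<open>X\<^sub>n\<close>, the residuals \<open>R\<^sub>n\<close> and \<open>R\<^sub>n\<^sup>*\<close>,
  the previous directions \<open>P\<^sub>n\<^sub>-\<^sub>1\<close> and \<open>P\<^sub>n\<^sub>-\<^sub>1\<^sup>*\<close>, and the scalar \<open>\<beta>\<^sub>n\<^sub>-\<^sub>1\<close>.
\<close>

record ptbicor_state =
  iterate :: tensor
  resid :: tensor
  dual_resid :: tensor
  prev_dir :: tensor
  prev_dual_dir :: tensor
  prev_beta :: real

definition ptbicor_init ::
    "nat \<Rightarrow> (nat \<Rightarrow> real mat) \<Rightarrow> (nat \<Rightarrow> real mat) \<Rightarrow> tensor \<Rightarrow> tensor \<Rightarrow> ptbicor_state" where
  "ptbicor_init N A Q D X0 =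
     (let R0 = (\<lambda>i. prec_rhs N Q D i - prec_op N A Q X0 i)
      in \<lparr>iterate = X0, resid = R0, dual_resid = prec_op N A Q R0,
          prev_dir = zero_tensor, prev_dual_dir = zero_tensor, prev_beta = 0\<rparr>)"

definition search_dir :: "ptbicor_state \<Rightarrow> tensor" where
  "search_dir s = (\<lambda>i. resid s i + prev_beta s * prev_dir s i)"

definition dual_search_dir :: "ptbicor_state \<Rightarrow> tensor" where
  "dual_search_dir s = (\<lambda>i. dual_resid s i + prev_beta s * prev_dual_dir s i)"

text \<open>
  The two inner products by which the algorithm divides: \<open>alpha_denom\<close> is the denominator of
  \<open>\<alpha>\<^sub>n\<close>; \<open>resid_pairing\<close> is both the numerator of \<open>\<alpha>\<^sub>n\<close> and the denominator of \<open>\<beta>\<^sub>n\<close>.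
\<close>

definition alpha_denom ::
    "nat \<Rightarrow> (nat \<Rightarrow> nat) \<Rightarrow> (nat \<Rightarrow> real mat) \<Rightarrow> (nat \<Rightarrow> real mat) \<Rightarrow> ptbicor_state \<Rightarrow> real" where
  "alpha_denom N I A Q s =
     tensor_inner N I (prec_op_transp N A Q (dual_search_dir s)) (prec_op N A Q (search_dir s))"

definition resid_pairing ::
    "nat \<Rightarrow> (nat \<Rightarrow> nat) \<Rightarrow> (nat \<Rightarrow> real mat) \<Rightarrow> (nat \<Rightarrow> real mat) \<Rightarrow> ptbicor_state \<Rightarrow> real" where
  "resid_pairing N I A Q s = tensor_inner N I (dual_resid s) (prec_op N A Q (resid s))"

definition ptbicor_step ::
    "nat \<Rightarrow> (nat \<Rightarrow> nat) \<Rightarrow> (nat \<Rightarrow> real mat) \<Rightarrow> (nat \<Rightarrow> real mat) \<Rightarrow> ptbicor_state \<Rightarrow> ptbicor_state" where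
  "ptbicor_step N I A Q s =
     (let P = search_dir s;
          P' = dual_search_dir s;
          S = prec_op N A Q P;
          S' = prec_op_transp N A Q P';
          \<alpha> = resid_pairing N I A Q s / alpha_denom N I A Q s;
          X = (\<lambda>i. iterate s i + \<alpha> * P i);
          R = (\<lambda>i. resid s i - \<alpha> * S i);
          R' = (\<lambda>i. dual_resid s i - \<alpha> * S' i);
          T = prec_op N A Q R;
          \<beta> = tensor_inner N I R' T / resid_pairing N I A Q s
      in \<lparr>iterate = X, resid = R, dual_resid = R',
          prev_dir = P, prev_dual_dir = P', prev_beta = \<beta>\<rparr>)"

primrec ptbicor ::
    "nat \<Rightarrow> (nat \<Rightarrow> nat) \<Rightarrow> (nat \<Rightarrow> real mat) \<Rightarrow> (nat \<Rightarrow> real mat) \<Rightarrow> tensor \<Rightarrow> tensor \<Rightarrow> nat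
      \<Rightarrow> ptbicor_state" where
  "ptbicor N I A Q D X0 0 = ptbicor_init N A Q D X0"
| "ptbicor N I A Q D X0 (Suc n) = ptbicor_step N I A Q (ptbicor N I A Q D X0 n)"

text \<open>In exact arithmetic the algorithm has converged when the residual is zero.\<close>

definition ptbicor_running ::
    "nat \<Rightarrow> (nat \<Rightarrow> nat) \<Rightarrow> (nat \<Rightarrow> real mat) \<Rightarrow> (nat \<Rightarrow> real mat) \<Rightarrow> tensor \<Rightarrow> tensor \<Rightarrow> nat
      \<Rightarrow> bool" where
  "ptbicor_running N I A Q D X0 n \<longleftrightarrow>
     (\<forall>k\<le>n. resid (ptbicor N I A Q D X0 k) \<noteq> zero_tensor)"

text \<open>
  Division by zero yields zero in HOL, so the recursion above would silently continue past a
  breakdown. The algorithm is well defined if no division carried out before convergence has a zero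
  denominator; \<open>\<beta>\<^sub>n\<close> is only needed if the algorithm does not stop with \<open>R\<^sub>n\<^sub>+\<^sub>1\<close>.
\<close>

definition ptbicor_no_breakdown ::
    "nat \<Rightarrow> (nat \<Rightarrow> nat) \<Rightarrow> (nat \<Rightarrow> real mat) \<Rightarrow> (nat \<Rightarrow> real mat) \<Rightarrow> tensor \<Rightarrow> tensor \<Rightarrow> bool" where
  "ptbicor_no_breakdown N I A Q D X0 \<longleftrightarrow>
     (\<forall>n. (ptbicor_running N I A Q D X0 n \<longrightarrow>
             alpha_denom N I A Q (ptbicor N I A Q D X0 n) \<noteq> 0) \<and>
          (ptbicor_running N I A Q D X0 (Suc n) \<longrightarrow>
             resid_pairing N I A Q (ptbicor N I A Q D X0 n) \<noteq> 0))"

end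

theory Submission
  imports Defs "Jordan_Normal_Form.Determinant"
begin

text \<open>
  Write \<open>L\<close> for the preconditioned operator and \<open>L\<^sup>T\<close> for its transpose. Transposing the factor of
  every mode gives the adjoint, because products in different modes commute
  (\<open>multi_mode_prod_adjoint\<close>, \<open>prec_op_adjoint\<close>). With respect to the bilinear form
  \<open>B(X, Y) = \<langle>X, L Y\<rangle>\<close> this says \<open>B(L\<^sup>T X, Y) = B(X, L Y)\<close>, and the iteration is the biconjugate
  gradient recurrence with \<open>B\<close> in place of the inner product. The usual induction therefore shows
  that, while no denominator vanishes, \<open>B(R\<^sub>i\<^sup>*, R\<^sub>j) = 0\<close> and
  \<open>\<langle>L\<^sup>T P\<^sub>i\<^sup>*, L P\<^sub>j\<rangle> = 0\<close> for \<open>i < j\<close> (\<open>bicor_triangular\<close>, \<open>dual_images_triangular\<close>).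

  If none of the residuals \<open>R\<^sub>0, ..., R\<^sub>M\<close> were zero, then all denominators
  \<open>\<langle>L\<^sup>T P\<^sub>i\<^sup>*, L P\<^sub>i\<rangle>\<close> with \<open>i \<le> M\<close> would be nonzero. The matrix of the pairings
  \<open>\<langle>L\<^sup>T P\<^sub>i\<^sup>*, L P\<^sub>j\<rangle>\<close> would be triangular of order M + 1 with nonzero diagonal, hence of rank M + 1,
  although it factors through the tensor space, which has dimension M
  (\<open>triangular_pairing_le_card\<close>). So some \<open>R\<^sub>n\<close> with \<open>n \<le> M\<close> is zero.

  The recursively updated residual is the true one, \<open>R\<^sub>n = D\<^sub>Q - L X\<^sub>n\<close> with \<open>D\<^sub>Q\<close> the preconditioned
  right-hand side (\<open>resid_eq\<close>), so \<open>X\<^sub>n\<close> solves the preconditioned equation. That equation is the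
  Sylvester equation multiplied in every mode by an invertible matrix, and invertible factors can be
  cancelled mode by mode (\<open>prec_op_eq_sylvester_op\<close>, \<open>multi_mode_prod_cancel\<close>).
\<close>

section \<open>Biorthogonality and dimension\<close>

text \<open>
  The biorthogonality argument needs only scalars, arranged in four tables. In the application they are
  \<open>b i j = \<langle>R\<^sub>i\<^sup>*, L R\<^sub>j\<rangle>\<close>, \<open>c i j = \<langle>L\<^sup>T P\<^sub>i\<^sup>*, L P\<^sub>j\<rangle>\<close>, \<open>d i j = \<langle>R\<^sub>i\<^sup>*, L (L P\<^sub>j)\<rangle>\<close> and
  \<open>e i j = \<langle>L\<^sup>T P\<^sub>i\<^sup>*, L R\<^sub>j\<rangle>\<close>, and the recurrences are the updates of the residuals and directions
  paired with a fixed tensor. The induction closes on the entries above the diagonal alone: the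
  choice of \<open>\<alpha>\<close> annihilates the entry of \<open>b\<close> next to the diagonal, the choice of \<open>\<beta>\<close> that of
  \<open>c\<close>, and the entries further away inherit zero from the previous column.
\<close>

lemma bicor_triangular:
  fixes b c d e :: "nat \<Rightarrow> nat \<Rightarrow> real" and \<alpha> \<beta> :: "nat \<Rightarrow> real"
  assumes b_right: "\<And>i j. b i (Suc j) = b i j - \<alpha> j * d i j"
    and b_left: "\<And>i j. b (Suc i) j = b i j - \<alpha> i * e i j"
    and c_0: "\<And>j. c 0 j = d 0 j"
    and c_left: "\<And>i j. c (Suc i) j = d (Suc i) j + \<beta> i * c i j"
    and c_right: "\<And>i j. c i (Suc j) = e i (Suc j) + \<beta> j * c i j"
    and \<alpha>: "\<And>k. \<alpha> k = b k k / c k k"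
    and \<beta>: "\<And>k. \<beta> k = b (Suc k) (Suc k) / b k k"
    and c_nz: "\<And>k. k \<le> m \<Longrightarrow> c k k \<noteq> 0"
    and b_nz: "\<And>k. k < m \<Longrightarrow> b k k \<noteq> 0"
  shows "j \<le> m \<Longrightarrow> \<forall>i<j. b i j = 0 \<and> c i j = 0"
proof (induction j)
  case 0
  then show ?case by simp
next
  case (Suc n)
  then have b_n: "b i n = 0" and c_n: "c i n = 0" if "i < n" for i
    using that by auto
  have nm: "n < m" using Suc.prems by simp
  (* Off the diagonal, a dual residual is a combination of two dual directions. *)
  have d_n: "d i n = c i n" if "i \<le> n" for i
  proof (cases i)
    case 0
    then show ?thesis by (simp add: c_0)
  next
    case (Suc i')
    then show ?thesis using c_left[of i' n] c_n[of i'] that by simp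
  qed
  have b_Suc: "b i (Suc n) = 0" if "i \<le> n" for i
  proof (cases "i = n")
    case True
    then show ?thesis using b_right[of n n] d_n[of n] \<alpha>[of n] c_nz[of n] nm by simp
  next
    case False
    then show ?thesis using that b_right[of i n] d_n[of i] b_n[of i] c_n[of i] by simp
  qed
  have c_Suc: "c i (Suc n) = 0" if "i \<le> n" for i
  proof (cases "i = n")
    case True
    (* L^T P_n^* is a multiple of a difference of dual residuals, which b evaluates. *)
    have "\<alpha> n * e n (Suc n) = - b (Suc n) (Suc n)"
      using b_left[of n "Suc n"] b_Suc[of n] by simp
    then have "e n (Suc n) = - b (Suc n) (Suc n) * c n n / b n n"
      using \<alpha>[of n] b_nz[of n] c_nz[of n] nm by (simp add: field_simps)
    then show ?thesis using True c_right[of n n] \<beta>[of n] by simp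
  next
    case False
    then have "\<alpha> i * e i (Suc n) = 0"
      using that b_left[of i "Suc n"] b_Suc[of i] b_Suc[of "Suc i"] by simp
    moreover have "\<alpha> i \<noteq> 0"
      using that nm \<alpha>[of i] b_nz[of i] c_nz[of i] by simp
    ultimately show ?thesis using that False c_right[of i n] c_n[of i] by simp
  qed
  show ?case using b_Suc c_Suc by (simp add: less_Suc_eq_le)
qed

text \<open>
  A triangular matrix of pairings with nonzero diagonal has full rank \<open>m\<close>, while it is a product of matrices
  with inner dimension \<open>card K\<close>.
\<close>

lemma triangular_pairing_le_card:
  fixes x y :: "nat \<Rightarrow> 'k \<Rightarrow> real"
  assumes K: "finite K"
    and diag: "\<And>i. i < m \<Longrightarrow> (\<Sum>k\<in>K. x i k * y i k) \<noteq> 0"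
    and upper: "\<And>i j. i < j \<Longrightarrow> j < m \<Longrightarrow> (\<Sum>k\<in>K. x i k * y j k) = 0"
  shows "m \<le> card K"
proof (rule ccontr)
  assume "\<not> m \<le> card K"
  then have less: "card K < m" by simp
  obtain f where f: "bij_betw f {0..<card K} K"
    using ex_bij_betw_nat_finite[OF K] by blast
  (* Padding both factors with zeros makes them square, and then singular. *)
  define F where "F = mat m m (\<lambda>(i, k). if k < card K then x i (f k) else 0)"
  define G where "G = mat m m (\<lambda>(k, j). if k < card K then y j (f k) else 0)"
  have F: "F \<in> carrier_mat m m" and G: "G \<in> carrier_mat m m"
    by (auto simp: F_def G_def)
  have entry: "(F * G) $$ (i, j) = (\<Sum>k\<in>K. x i k * y j k)" if "i < m" "j < m" for i j
  proof -
    have "(F * G) $$ (i, j) =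
        (\<Sum>k\<in>{0..<m}. if k < card K then x i (f k) * y j (f k) else 0)"
      using that by (auto simp: F_def G_def scalar_prod_def intro!: sum.cong)
    also have "\<dots> = (\<Sum>k\<in>{0..<card K}. x i (f k) * y j (f k))"
      using less by (intro sum.mono_neutral_cong_right) auto
    also have "\<dots> = (\<Sum>k\<in>K. x i k * y j k)"
      by (rule sum.reindex_bij_betw[OF f])
    finally show ?thesis .
  qed
  have "(\<Prod>i = 0..<m. G $$ (i, p i)) = 0" if "p permutes {0..<m}" for p
    using less permutes_in_image[OF that, of "card K"]
    by (intro prod_zero) (auto intro!: bexI[of _ "card K"] simp: G_def)
  then have "det G = 0"
    unfolding det_def'[OF G] by (intro sum.neutral ballI) (simp only: mem_Collect_eq mult_zero_right)
  then have "det (F * G) = 0" by (simp add: det_mult[OF F G])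
  moreover have "det (F * G) = prod_list (diag_mat (F * G))"
    using F G upper by (intro det_lower_triangular[of m]) (auto simp: entry simp del: index_mult_mat(1))
  moreover have "0 \<notin> set (diag_mat (F * G))"
    using F G diag by (auto simp: diag_mat_def entry simp del: index_mult_mat(1))
  ultimately show False by (simp add: prod_list_zero_iff)
qed


section \<open>Mode products\<close>

lemma finite_multi_indices: "finite (multi_indices N I)"
  by (simp add: multi_indices_def finite_PiE)

lemma card_multi_indices: "card (multi_indices N I) = (\<Prod>k=1..N. I k)"
  by (simp add: multi_indices_def card_PiE)

lemma fun_upd_in_multi_indices:
  assumes "n \<in> {1..N}" "k < I n" "i \<in> multi_indices N I"
  shows "i(n := k) \<in> multi_indices N I"
  using assms by (auto simp: multi_indices_def PiE_iff extensional_def)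

lemma fun_upd_multi_indicesD:
  assumes "n \<in> {1..N}" "i n < I n" "i(n := k) \<in> multi_indices N I"
  shows "i \<in> multi_indices N I"
  using fun_upd_in_multi_indices[OF assms(1,2,3)] by simp

lemma tensor_space_combination:
  assumes "X \<in> tensor_space N I" "Y \<in> tensor_space N I"
  shows "(\<lambda>i. X i + a * Y i) \<in> tensor_space N I"
    and "(\<lambda>i. X i - a * Y i) \<in> tensor_space N I"
  using assms by (auto simp: tensor_space_def)

text \<open>
  Changing a coordinate that already lies within its bound cannot move a multi-index into the box.
\<close>

lemma mode_prod_in_tensor_space:
  assumes "n \<in> {1..N}" "B \<in> carrier_mat (I n) (I n)" "X \<in> tensor_space N I"
  shows "mode_prod X n B \<in> tensor_space N I"
proof -
  have "X (i(n := k)) = 0" if "i \<notin> multi_indices N I" "i n < I n" for i k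
    using assms that fun_upd_multi_indicesD[of n N i I k] by (auto simp: tensor_space_def)
  then show ?thesis using assms(2) by (auto simp: tensor_space_def mode_prod_def)
qed

lemma mode_prod_commute:
  assumes "n \<noteq> m"
  shows "mode_prod (mode_prod X n B) m C = mode_prod (mode_prod X m C) n B"
proof
  fix i
  let ?s = "\<lambda>k l. X (i(n := l, m := k)) * B $$ (i n, l) * C $$ (i m, k)"
  have swap: "i(m := k, n := l) = i(n := l, m := k)" for k l
    using assms by (simp add: fun_upd_twist)
  show "mode_prod (mode_prod X n B) m C i = mode_prod (mode_prod X m C) n B i"
  proof (cases "i n < dim_row B \<and> i m < dim_row C")
    case True
    have "mode_prod (mode_prod X n B) m C i = (\<Sum>k<dim_col C. \<Sum>l<dim_col B. ?s k l)"
      using True assms by (simp add: mode_prod_def sum_distrib_right swap)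
    also have "\<dots> = (\<Sum>l<dim_col B. \<Sum>k<dim_col C. ?s k l)"
      by (rule sum.swap)
    also have "\<dots> = mode_prod (mode_prod X m C) n B i"
      using True assms by (simp add: mode_prod_def sum_distrib_left ac_simps)
    finally show ?thesis .
  next
    case False
    then show ?thesis using assms by (auto simp: mode_prod_def)
  qed
qed

lemma mode_prod_mode_prod:
  assumes "dim_col C = dim_row B"
  shows "mode_prod (mode_prod X n B) n C = mode_prod X n (C * B)"
proof
  fix i
  let ?s = "\<lambda>k l. X (i(n := l)) * B $$ (k, l) * C $$ (i n, k)"
  show "mode_prod (mode_prod X n B) n C i = mode_prod X n (C * B) i"
  proof (cases "i n < dim_row C")
    case True
    have "mode_prod (mode_prod X n B) n C i = (\<Sum>k<dim_row B. \<Sum>l<dim_col B. ?s k l)"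
      using True assms by (simp add: mode_prod_def sum_distrib_right)
    also have "\<dots> = (\<Sum>l<dim_col B. \<Sum>k<dim_row B. ?s k l)"
      by (rule sum.swap)
    also have "\<dots> = mode_prod X n (C * B) i"
      using True assms
      by (simp add: mode_prod_def scalar_prod_def sum_distrib_left atLeast0LessThan mult_ac)
    finally show ?thesis .
  next
    case False
    then show ?thesis by (simp add: mode_prod_def)
  qed
qed

lemma mode_prod_one:
  assumes "n \<in> {1..N}" "X \<in> tensor_space N I"
  shows "mode_prod X n (1\<^sub>m (I n)) = X"
proof
  fix i
  show "mode_prod X n (1\<^sub>m (I n)) i = X i"
  proof (cases "i n < I n")
    case True
    have "(\<Sum>k<I n. X (i(n := k)) * 1\<^sub>m (I n) $$ (i n, k)) =
        (\<Sum>k<I n. if k = i n then X i else 0)"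
      using True by (intro sum.cong) auto
    then show ?thesis using True by (simp add: mode_prod_def)
  next
    case False
    then have "i \<notin> multi_indices N I"
      using assms(1) by (auto simp: multi_indices_def)
    then show ?thesis
      using False assms(2) by (simp add: mode_prod_def tensor_space_def)
  qed
qed

lemma mode_prod_adjoint:
  assumes n: "n \<in> {1..N}" and B: "B \<in> carrier_mat (I n) (I n)"
  shows "tensor_inner N I (mode_prod X n (transpose_mat B)) Y =
         tensor_inner N I X (mode_prod Y n B)"
proof -
  let ?J = "multi_indices N I"
  have bound: "i n < I n" if "i \<in> ?J" for i
    using that n by (auto simp: multi_indices_def)
  have "tensor_inner N I (mode_prod X n (transpose_mat B)) Y =
      (\<Sum>i\<in>?J. \<Sum>k<I n. X (i(n := k)) * B $$ (k, i n) * Y i)"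
    unfolding tensor_inner_def using B bound
    by (intro sum.cong) (auto simp: mode_prod_def sum_distrib_right)
  also have "\<dots> = (\<Sum>(i, k)\<in>?J \<times> {..<I n}. X (i(n := k)) * B $$ (k, i n) * Y i)"
    by (rule sum.cartesian_product)
  also have "\<dots> = (\<Sum>(i, k)\<in>?J \<times> {..<I n}. X i * (Y (i(n := k)) * B $$ (i n, k)))"
    (* Exchange the contracted index with the free index of mode n. *)
    by (rule sum.reindex_bij_witness[where i = "\<lambda>(i, k). (i(n := k), i n)"
          and j = "\<lambda>(i, k). (i(n := k), i n)"])
       (use n bound in \<open>auto intro: fun_upd_in_multi_indices\<close>)
  also have "\<dots> = (\<Sum>i\<in>?J. \<Sum>k<I n. X i * (Y (i(n := k)) * B $$ (i n, k)))"
    by (rule sum.cartesian_product[symmetric])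
  also have "\<dots> = tensor_inner N I X (mode_prod Y n B)"
    unfolding tensor_inner_def using B bound
    by (intro sum.cong) (auto simp: mode_prod_def sum_distrib_left)
  finally show ?thesis .
qed


section \<open>Linear maps of tensors\<close>

definition tensor_linear :: "(tensor \<Rightarrow> tensor) \<Rightarrow> bool" where
  "tensor_linear F \<longleftrightarrow> (\<forall>X Y a. F (\<lambda>i. X i + a * Y i) = (\<lambda>i. F X i + a * F Y i))"

lemma tensor_linear_add:
  "tensor_linear F \<Longrightarrow> F (\<lambda>i. X i + a * Y i) = (\<lambda>i. F X i + a * F Y i)"
  by (simp add: tensor_linear_def)

lemma tensor_linear_diff:
  "tensor_linear F \<Longrightarrow> F (\<lambda>i. X i - a * Y i) = (\<lambda>i. F X i - a * F Y i)"
  using tensor_linear_add[of F X "- a" Y] by simp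

lemma tensor_linear_zero:
  assumes "tensor_linear F"
  shows "F (\<lambda>i. 0) = (\<lambda>i. 0)"
  using tensor_linear_diff[OF assms, of "\<lambda>i. 0" 1 "\<lambda>i. 0"] by simp

lemma tensor_linear_sum:
  assumes "tensor_linear F"
  shows "F (\<lambda>i. \<Sum>n\<in>S. Y n i) = (\<lambda>i. \<Sum>n\<in>S. F (Y n) i)"
proof (induction S rule: infinite_finite_induct)
  case (insert n S)
  then show ?case
    using tensor_linear_add[OF assms, of "\<lambda>i. \<Sum>n\<in>S. Y n i" 1 "Y n"]
    by (simp add: add.commute)
qed (simp_all add: tensor_linear_zero[OF assms])

lemma tensor_linear_sum_fun:
  assumes "\<And>n. tensor_linear (F n)"
  shows "tensor_linear (\<lambda>X i. \<Sum>n\<in>S. F n X i)"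
  using assms by (simp add: tensor_linear_def sum.distrib sum_distrib_left)

lemma tensor_linear_mode_prod: "tensor_linear (\<lambda>X. mode_prod X n B)"
  by (auto simp: tensor_linear_def mode_prod_def fun_eq_iff algebra_simps
      sum.distrib sum_distrib_left)

lemma tensor_linear_multi_mode_prod: "tensor_linear (\<lambda>X. multi_mode_prod N X B)"
proof (induction N)
  case (Suc N)
  then show ?case
    using tensor_linear_mode_prod by (simp add: tensor_linear_def)
qed (simp add: tensor_linear_def)

lemma tensor_linear_prec_op: "tensor_linear (prec_op N A Q)"
  unfolding prec_op_def[abs_def]
  by (intro tensor_linear_sum_fun tensor_linear_multi_mode_prod)

text \<open>
  The inner product is expanded along the updates of the iteration, which have the forms \<open>X + a Y\<close>
  and \<open>X - a Y\<close>.
\<close>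

lemma tensor_inner_left_add:
  "tensor_inner N I (\<lambda>i. X i + a * Y i) Z = tensor_inner N I X Z + a * tensor_inner N I Y Z"
  by (simp add: tensor_inner_def algebra_simps sum.distrib sum_distrib_left)

lemma tensor_inner_left_diff:
  "tensor_inner N I (\<lambda>i. X i - a * Y i) Z = tensor_inner N I X Z - a * tensor_inner N I Y Z"
  using tensor_inner_left_add[of N I X "- a" Y Z] by simp

lemma tensor_inner_commute: "tensor_inner N I X Y = tensor_inner N I Y X"
  by (simp add: tensor_inner_def mult.commute)

lemma tensor_inner_right_add:
  "tensor_inner N I Z (\<lambda>i. X i + a * Y i) = tensor_inner N I Z X + a * tensor_inner N I Z Y"
  using tensor_inner_left_add by (simp add: tensor_inner_commute[of N I Z])

lemma tensor_inner_right_diff: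
  "tensor_inner N I Z (\<lambda>i. X i - a * Y i) = tensor_inner N I Z X - a * tensor_inner N I Z Y"
  using tensor_inner_left_diff by (simp add: tensor_inner_commute[of N I Z])


section \<open>Products in all modes\<close>

lemma multi_mode_prod_cong:
  "(\<And>m. m \<in> {1..n} \<Longrightarrow> B m = C m) \<Longrightarrow> multi_mode_prod n X B = multi_mode_prod n X C"
  by (induction n) auto

lemma multi_mode_prod_in_tensor_space:
  assumes "\<And>m. m \<in> {1..N} \<Longrightarrow> B m \<in> carrier_mat (I m) (I m)" "X \<in> tensor_space N I"
  shows "n \<le> N \<Longrightarrow> multi_mode_prod n X B \<in> tensor_space N I"
  using assms by (induction n) (auto intro!: mode_prod_in_tensor_space)

lemma multi_mode_prod_commute:
  "n < m \<Longrightarrow> multi_mode_prod n (mode_prod X m C) B = mode_prod (multi_mode_prod n X B) m C"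
  by (induction n) (auto simp: mode_prod_commute)

text \<open>
  Moving the factors across the inner product one by one reverses their order; commutation of
  different modes restores it.
\<close>

lemma multi_mode_prod_adjoint:
  assumes B: "\<And>m. m \<in> {1..N} \<Longrightarrow> B m \<in> carrier_mat (I m) (I m)"
  shows "n \<le> N \<Longrightarrow> tensor_inner N I (multi_mode_prod n X (\<lambda>m. transpose_mat (B m))) Y =
           tensor_inner N I X (multi_mode_prod n Y B)"
proof (induction n arbitrary: Y)
  case (Suc n)
  then show ?case
    using B mode_prod_adjoint[of "Suc n" N "B (Suc n)" I]
    by (simp add: multi_mode_prod_commute)
qed simp

text \<open>
  The factor \<open>C\<close> commutes past the products in the other modes and merges with the factor of its own
  mode.
\<close>

lemma multi_mode_prod_mode_prod:
  assumes "n \<in> {1..N}" "dim_col (B n) = dim_row C"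
  shows "multi_mode_prod N (mode_prod X n C) B = multi_mode_prod N X (B(n := B n * C))"
  using assms(1)
proof (induction N)
  case (Suc N)
  show ?case
  proof (cases "n = Suc N")
    case True
    have "multi_mode_prod N X (B(Suc N := B n * C)) = multi_mode_prod N X B"
      by (rule multi_mode_prod_cong) auto
    then show ?thesis
      using assms(2)
      by (simp only: True multi_mode_prod.simps fun_upd_same multi_mode_prod_commute[OF lessI]
          mode_prod_mode_prod)
  next
    case False
    then show ?thesis using Suc by simp
  qed
qed simp

text \<open>
  Left inverses of the factors undo the outermost product first, which leaves the same statement for
  one mode fewer.
\<close>

lemma multi_mode_prod_cancel:
  assumes B: "\<And>m. m \<in> {1..N} \<Longrightarrow>
      B m \<in> carrier_mat (I m) (I m) \<and> (\<exists>C. C \<in> carrier_mat (I m) (I m) \<and> C * B m = 1\<^sub>m (I m))"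
    and X: "X \<in> tensor_space N I" and Y: "Y \<in> tensor_space N I"
  shows "n \<le> N \<Longrightarrow> multi_mode_prod n X B = multi_mode_prod n Y B \<Longrightarrow> X = Y"
proof (induction n)
  case (Suc n)
  obtain C where C: "C \<in> carrier_mat (I (Suc n)) (I (Suc n))" "C * B (Suc n) = 1\<^sub>m (I (Suc n))"
    and BS: "B (Suc n) \<in> carrier_mat (I (Suc n)) (I (Suc n))"
    using B[of "Suc n"] Suc.prems(1) by auto
  have dims: "dim_col C = dim_row (B (Suc n))" using C(1) BS by simp
  have undo: "mode_prod (multi_mode_prod (Suc n) Z B) (Suc n) C = multi_mode_prod n Z B"
    if "Z \<in> tensor_space N I" for Z
    using C dims Suc.prems(1) B that
      mode_prod_one[of "Suc n" N "multi_mode_prod n Z B" I]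
      multi_mode_prod_in_tensor_space[of N B I Z n]
    by (simp add: mode_prod_mode_prod)
  have "multi_mode_prod n X B = multi_mode_prod n Y B"
    using undo[OF X] undo[OF Y] Suc.prems(2) by metis
  then show ?case using Suc by simp
qed simp


section \<open>The preconditioned equation\<close>

lemma inv_mat_inverse:
  assumes Q: "Q \<in> carrier_mat n n" and inv: "invertible_mat Q"
  shows "inv_mat Q \<in> carrier_mat n n" and "Q * inv_mat Q = 1\<^sub>m n"
proof -
  obtain B where B: "inverts_mat Q B" "inverts_mat B Q"
    using inv by (auto simp: invertible_mat_def)
  then have eq: "Q * B = 1\<^sub>m n" "B * Q = 1\<^sub>m (dim_row B)"
    using Q by (auto simp: inverts_mat_def)
  have "dim_col B = n" using arg_cong[OF eq(1), of dim_col] by simp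
  moreover have "dim_row B = n" using arg_cong[OF eq(2), of dim_col] Q by simp
  ultimately have "Q \<in> Units (ring_mat TYPE(real) n ())"
    using eq Q by (auto simp: Units_def ring_mat_def intro!: bexI[of _ B])
  then obtain C where "mat_inverse Q = Some C"
    using mat_inverse(1)[OF Q, of "()"] by (cases "mat_inverse Q") auto
  then show "inv_mat Q \<in> carrier_mat n n" and "Q * inv_mat Q = 1\<^sub>m n"
    using mat_inverse(2)[OF Q] by (auto simp: inv_mat_def)
qed

locale ptbicor_data =
  fixes N :: nat and I :: "nat \<Rightarrow> nat" and A Q :: "nat \<Rightarrow> real mat" and D X0 :: tensor
  assumes D: "D \<in> tensor_space N I"
    and A: "n \<in> {1..N} \<Longrightarrow> A n \<in> carrier_mat (I n) (I n)"
    and Q: "i \<in> {1..N} \<Longrightarrow>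
      Q i \<in> carrier_mat (I (N + 1 - i)) (I (N + 1 - i)) \<and> invertible_mat (Q i)"
    and X0: "X0 \<in> tensor_space N I"
begin

lemma prec_matrix:
  assumes "n \<in> {1..N}"
  shows "inv_mat (Q (N + 1 - n)) \<in> carrier_mat (I n) (I n)"
    and "Q (N + 1 - n) \<in> carrier_mat (I n) (I n)"
    and "Q (N + 1 - n) * inv_mat (Q (N + 1 - n)) = 1\<^sub>m (I n)"
proof -
  have "N + 1 - n \<in> {1..N}" "N + 1 - (N + 1 - n) = n" using assms by auto
  then have "Q (N + 1 - n) \<in> carrier_mat (I n) (I n)" "invertible_mat (Q (N + 1 - n))"
    using Q by metis+
  then show "inv_mat (Q (N + 1 - n)) \<in> carrier_mat (I n) (I n)"
    and "Q (N + 1 - n) \<in> carrier_mat (I n) (I n)"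
    and "Q (N + 1 - n) * inv_mat (Q (N + 1 - n)) = 1\<^sub>m (I n)"
    using inv_mat_inverse by blast+
qed

lemma prec_factor_carrier:
  assumes "m \<in> {1..N}"
  shows "prec_factor N A Q n m \<in> carrier_mat (I m) (I m)"
  using prec_matrix(1)[OF assms] A[OF assms] by (auto simp: prec_factor_def)

lemma tensor_space_sum:
  assumes "\<And>n. n \<in> S \<Longrightarrow> Y n \<in> tensor_space N I"
  shows "(\<lambda>i. \<Sum>n\<in>S. Y n i) \<in> tensor_space N I"
  using assms by (simp add: tensor_space_def)

lemma prec_op_in_tensor_space:
  "X \<in> tensor_space N I \<Longrightarrow> prec_op N A Q X \<in> tensor_space N I"
  unfolding prec_op_def using prec_factor_carrier
  by (intro tensor_space_sum multi_mode_prod_in_tensor_space) auto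

lemma prec_op_adjoint:
  "tensor_inner N I (prec_op_transp N A Q X) Y = tensor_inner N I X (prec_op N A Q Y)"
proof -
  have "tensor_inner N I (prec_op_transp N A Q X) Y =
      (\<Sum>n=1..N. tensor_inner N I
         (multi_mode_prod N X (\<lambda>m. transpose_mat (prec_factor N A Q n m))) Y)"
    unfolding tensor_inner_def prec_op_transp_def sum_distrib_right by (rule sum.swap)
  also have "\<dots> = (\<Sum>n=1..N. tensor_inner N I X (multi_mode_prod N Y (prec_factor N A Q n)))"
    using prec_factor_carrier by (intro sum.cong multi_mode_prod_adjoint) auto
  also have "\<dots> = tensor_inner N I X (prec_op N A Q Y)"
    unfolding tensor_inner_def prec_op_def sum_distrib_left by (rule sum.swap)
  finally show ?thesis .
qed

text \<open>
  Each summand of the preconditioned operator is a one-mode product with \<open>A n\<close> followed by the same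
  inverse factors in all modes, and the latter are linear.
\<close>

lemma prec_op_eq_sylvester_op:
  "prec_op N A Q X = prec_rhs N Q (sylvester_op N A X)"
proof -
  let ?B = "\<lambda>m. inv_mat (Q (N + 1 - m))"
  have "multi_mode_prod N X (prec_factor N A Q n) = multi_mode_prod N (mode_prod X n (A n)) ?B"
    if n: "n \<in> {1..N}" for n
  proof -
    have "prec_factor N A Q n = ?B(n := ?B n * A n)"
      by (auto simp: prec_factor_def fun_eq_iff)
    then show ?thesis
      using multi_mode_prod_mode_prod[OF n, of ?B "A n" X] prec_matrix(1)[OF n] A[OF n] by simp
  qed
  then show ?thesis
    unfolding prec_op_def prec_rhs_def sylvester_op_def
      tensor_linear_sum[OF tensor_linear_multi_mode_prod]
    by simp
qed

lemma sylvester_solution_if_prec_solution: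
  assumes X: "X \<in> tensor_space N I" and eq: "prec_op N A Q X = prec_rhs N Q D"
  shows "sylvester_solution N I A D X"
proof -
  have S: "sylvester_op N A X \<in> tensor_space N I"
    unfolding sylvester_op_def using A X
    by (intro tensor_space_sum mode_prod_in_tensor_space) auto
  have "sylvester_op N A X = D"
  proof (rule multi_mode_prod_cancel[where N = N and I = I and n = N, OF _ S D])
    show "inv_mat (Q (N + 1 - n)) \<in> carrier_mat (I n) (I n) \<and>
        (\<exists>C. C \<in> carrier_mat (I n) (I n) \<and> C * inv_mat (Q (N + 1 - n)) = 1\<^sub>m (I n))"
      if "n \<in> {1..N}" for n
      using prec_matrix[OF that] by blast
    show "multi_mode_prod N (sylvester_op N A X) (\<lambda>n. inv_mat (Q (N + 1 - n))) =
        multi_mode_prod N D (\<lambda>n. inv_mat (Q (N + 1 - n)))"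
      using eq by (simp only: prec_op_eq_sylvester_op prec_rhs_def)
  qed auto
  then show ?thesis using X by (simp add: sylvester_solution_def)
qed


section \<open>The iteration\<close>

abbreviation "L \<equiv> prec_op N A Q"
abbreviation "L' \<equiv> prec_op_transp N A Q"
abbreviation "st k \<equiv> ptbicor N I A Q D X0 k"
abbreviation "R k \<equiv> resid (st k)"
abbreviation "R' k \<equiv> dual_resid (st k)"
abbreviation "P k \<equiv> search_dir (st k)"
abbreviation "P' k \<equiv> dual_search_dir (st k)"

definition step_alpha :: "nat \<Rightarrow> real" where
  "step_alpha k = resid_pairing N I A Q (st k) / alpha_denom N I A Q (st k)"

definition step_beta :: "nat \<Rightarrow> real" where
  "step_beta k = resid_pairing N I A Q (st (Suc k)) / resid_pairing N I A Q (st k)"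

lemma iterate_Suc: "iterate (st (Suc k)) = (\<lambda>i. iterate (st k) i + step_alpha k * P k i)"
  by (simp add: ptbicor_step_def Let_def step_alpha_def)

lemma resid_Suc: "R (Suc k) = (\<lambda>i. R k i - step_alpha k * L (P k) i)"
  by (simp add: ptbicor_step_def Let_def step_alpha_def)

lemma dual_resid_Suc: "R' (Suc k) = (\<lambda>i. R' k i - step_alpha k * L' (P' k) i)"
  by (simp add: ptbicor_step_def Let_def step_alpha_def)

lemma prev_beta_Suc: "prev_beta (st (Suc k)) = step_beta k"
  by (simp add: ptbicor_step_def Let_def step_beta_def resid_pairing_def)

lemma search_dir_0: "P 0 = R 0" and dual_search_dir_0: "P' 0 = R' 0"
  by (simp_all add: search_dir_def dual_search_dir_def ptbicor_init_def Let_def)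

lemma search_dir_Suc: "P (Suc k) = (\<lambda>i. R (Suc k) i + step_beta k * P k i)"
proof -
  have "prev_dir (st (Suc k)) = P k" by (simp add: ptbicor_step_def Let_def)
  then show ?thesis
    using prev_beta_Suc by (simp add: search_dir_def[of "st (Suc k)"] del: ptbicor.simps)
qed

lemma dual_search_dir_Suc: "P' (Suc k) = (\<lambda>i. R' (Suc k) i + step_beta k * P' k i)"
proof -
  have "prev_dual_dir (st (Suc k)) = P' k" by (simp add: ptbicor_step_def Let_def)
  then show ?thesis
    using prev_beta_Suc by (simp add: dual_search_dir_def[of "st (Suc k)"] del: ptbicor.simps)
qed

lemma resid_0: "R 0 = (\<lambda>i. prec_rhs N Q D i - L X0 i)"
  by (simp add: ptbicor_init_def Let_def)

lemma primal_in_tensor_space: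
  "iterate (st k) \<in> tensor_space N I \<and> R k \<in> tensor_space N I \<and> P k \<in> tensor_space N I"
proof (induction k)
  case 0
  have "prec_rhs N Q D \<in> tensor_space N I"
    unfolding prec_rhs_def using prec_matrix(1) D by (intro multi_mode_prod_in_tensor_space) auto
  then have "R 0 \<in> tensor_space N I"
    using tensor_space_combination(2)[of _ N I "L X0" 1] prec_op_in_tensor_space[OF X0]
    by (simp add: resid_0 del: ptbicor.simps)
  moreover have "iterate (st 0) = X0" by (simp add: ptbicor_init_def Let_def)
  ultimately show ?case using X0 search_dir_0 by simp
next
  case (Suc k)
  then have "R (Suc k) \<in> tensor_space N I"
    by (simp add: resid_Suc tensor_space_combination prec_op_in_tensor_space del: ptbicor.simps)
  then show ?case using Suc
    by (simp add: iterate_Suc search_dir_Suc tensor_space_combination del: ptbicor.simps)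
qed

text \<open>
  Both the iterate and the residual move along the search direction with the same step length, so by
  linearity the updated residual stays the residual of the current iterate.
\<close>

lemma resid_eq: "R k = (\<lambda>i. prec_rhs N Q D i - L (iterate (st k)) i)"
proof (induction k)
  case 0
  then show ?case by (simp add: ptbicor_init_def Let_def)
next
  case (Suc k)
  then show ?case
    by (simp add: resid_Suc iterate_Suc tensor_linear_add[OF tensor_linear_prec_op]
        algebra_simps del: ptbicor.simps)
qed

lemma sylvester_solution_if_resid_zero:
  assumes "R k = zero_tensor"
  shows "sylvester_solution N I A D (iterate (st k))"
proof (rule sylvester_solution_if_prec_solution)
  show "L (iterate (st k)) = prec_rhs N Q D"
    using assms resid_eq[of k] by (simp add: zero_tensor_def fun_eq_iff)
qed (use primal_in_tensor_space in blast)

text \<open>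
  The recurrences of \<open>bicor_triangular\<close> hold for arbitrary indices; adjointness enters
  only where a transposed operator on \<open>P\<^sub>i\<^sup>*\<close> is moved to the second argument to use the update of
  \<open>P\<^sub>i\<^sup>*\<close>.
\<close>

lemma dual_images_triangular:
  assumes "\<And>k. k \<le> m \<Longrightarrow> alpha_denom N I A Q (st k) \<noteq> 0"
    and "\<And>k. k < m \<Longrightarrow> resid_pairing N I A Q (st k) \<noteq> 0"
    and "i < j" "j \<le> m"
  shows "tensor_inner N I (L' (P' i)) (L (P j)) = 0"
proof -
  note lin = tensor_linear_add[OF tensor_linear_prec_op] tensor_linear_diff[OF tensor_linear_prec_op]
    tensor_inner_left_add tensor_inner_left_diff tensor_inner_right_add tensor_inner_right_diff
  define b where "b i j = tensor_inner N I (R' i) (L (R j))" for i j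
  define c where "c i j = tensor_inner N I (L' (P' i)) (L (P j))" for i j
  define d where "d i j = tensor_inner N I (R' i) (L (L (P j)))" for i j
  define e where "e i j = tensor_inner N I (L' (P' i)) (L (R j))" for i j
  have "\<forall>i<j. b i j = 0 \<and> c i j = 0"
  proof (rule bicor_triangular[where b = b and c = c and d = d and e = e
        and \<alpha> = step_alpha and \<beta> = step_beta and m = m])
    show "b i (Suc j) = b i j - step_alpha j * d i j" for i j
      by (simp add: b_def d_def resid_Suc lin del: ptbicor.simps)
    show "b (Suc i) j = b i j - step_alpha i * e i j" for i j
      by (simp add: b_def e_def dual_resid_Suc lin del: ptbicor.simps)
    show "c 0 j = d 0 j" for j
      by (simp add: c_def d_def prec_op_adjoint dual_search_dir_0 del: ptbicor.simps)
    show "c (Suc i) j = d (Suc i) j + step_beta i * c i j" for i j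
      by (simp add: c_def d_def prec_op_adjoint dual_search_dir_Suc lin del: ptbicor.simps)
    show "c i (Suc j) = e i (Suc j) + step_beta j * c i j" for i j
      by (simp add: c_def e_def search_dir_Suc lin del: ptbicor.simps)
    show "step_alpha k = b k k / c k k" for k
      by (simp add: step_alpha_def b_def c_def resid_pairing_def alpha_denom_def)
    show "step_beta k = b (Suc k) (Suc k) / b k k" for k
      by (simp add: step_beta_def b_def resid_pairing_def)
    show "c k k \<noteq> 0" if "k \<le> m" for k
      using assms(1)[OF that] by (simp add: c_def alpha_denom_def)
    show "b k k \<noteq> 0" if "k < m" for k
      using assms(2)[OF that] by (simp add: b_def resid_pairing_def)
  qed fact
  then show ?thesis using assms(3) by (simp add: c_def)
qed

text \<open>
  Running through step M provides M + 1 nonzero denominators of \<open>\<alpha>\<close>, one more than the dimension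
  allows. The last of them belongs to step M itself, whereas \<open>\<beta>\<close> is needed only before step M.
\<close>

lemma resid_zero_within_dimension:
  assumes "ptbicor_no_breakdown N I A Q D X0"
  shows "\<exists>n \<le> (\<Prod>k=1..N. I k). R n = zero_tensor"
proof (rule ccontr)
  define M where "M = (\<Prod>k=1..N. I k)"
  assume "\<not> (\<exists>n \<le> (\<Prod>k=1..N. I k). R n = zero_tensor)"
  then have "R k \<noteq> zero_tensor" if "k \<le> M" for k
    using that unfolding M_def by blast
  then have run: "ptbicor_running N I A Q D X0 k" if "k \<le> M" for k
    unfolding ptbicor_running_def using that by (meson le_trans)
  have denom: "alpha_denom N I A Q (st k) \<noteq> 0" if "k \<le> M" for k
    using assms run[OF that] unfolding ptbicor_no_breakdown_def by blast
  have pairing: "resid_pairing N I A Q (st k) \<noteq> 0" if "k < M" for k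
    using assms run[OF Suc_leI[OF that]] unfolding ptbicor_no_breakdown_def by blast
  have "Suc M \<le> card (multi_indices N I)"
  proof (rule triangular_pairing_le_card[where x = "\<lambda>i. L' (P' i)" and y = "\<lambda>j. L (P j)"])
    show "(\<Sum>k\<in>multi_indices N I. L' (P' i) k * L (P i) k) \<noteq> 0" if "i < Suc M" for i
      using denom[of i] that by (simp add: alpha_denom_def tensor_inner_def)
    show "(\<Sum>k\<in>multi_indices N I. L' (P' i) k * L (P j) k) = 0" if "i < j" "j < Suc M" for i j
      using dual_images_triangular[OF denom pairing \<open>i < j\<close>, of M] \<open>j < Suc M\<close>
      by (simp add: tensor_inner_def)
  qed (rule finite_multi_indices)
  then show False by (simp add: M_def card_multi_indices)
qed

end

theorem theorem4:
  fixes N :: nat and I :: "nat \<Rightarrow> nat"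
    and A Q :: "nat \<Rightarrow> real mat"
    and D X0 :: tensor
  assumes "1 \<le> N"
    and "\<forall>n\<in>{1..N}. 1 \<le> I n"
    and "D \<in> tensor_space N I"
    and "\<forall>n\<in>{1..N}. A n \<in> carrier_mat (I n) (I n)"
    and "\<forall>i\<in>{1..N}. Q i \<in> carrier_mat (I (N + 1 - i)) (I (N + 1 - i)) \<and> invertible_mat (Q i)"
    and "sylvester_consistent N I A D"
    and "X0 \<in> tensor_space N I"
    and "ptbicor_no_breakdown N I A Q D X0"
  shows "\<exists>n \<le> (\<Prod>k=1..N. I k).
           resid (ptbicor N I A Q D X0 n) = zero_tensor \<and>
           sylvester_solution N I A D (iterate (ptbicor N I A Q D X0 n))"
proof -
  interpret ptbicor_data N I A Q D X0
    using assms(3,4,5,7) by unfold_locales auto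
  show ?thesis
    using resid_zero_within_dimension[OF assms(8)] sylvester_solution_if_resid_zero by blast
qed

end
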